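(* Let $A,X,Y$ be pointed topological spaces. If a pointed map $j:A\to X$ is a free (resp. closed free) cofibration, then, for any pointed map $f:X\to Y$, the map $1_Y\cup Cj:Y\cup_{f\circ j}CA\to Y\cup_fCX$ is a free (resp. closed free) cofibration.
   Context: A free cofibration is a continuous map $j:A\to X$ having the homotopy extension property with respect to all topological spaces in the category of (unpointed) topological spaces: for all maps $u:X\to W$ and $G:A\times I\to W$ with $u\circ j=G(\cdot,0)$ there is $H:X\times I\to W$ with $H\circ(j\times1_I)=G$, $H(\cdot,0)=u$. It is a closed free cofibration if moreover $j$ maps closed subsets to closed subsets. $I=[0,1]$. For a pointed space $X$ with base point $x_0$, the (pointed) cone is $CX=(X\times I)/(\{x_0\}\times I\cup X\times\{1\})$, with points $x\wedge t$. For a pointed map $f:X\to Y$, the pointed mapping cone $Y\cup_fCX$ is the quotient of the topological sum $Y+CX$ by $f(x)\sim x\wedge0$. The map $1_Y\cup Cj$ is the identity on $Y$ and sends $a\wedge t$ to $j(a)\wedge t$. *)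

theory Defs
  imports "HOL-Analysis.Analysis"
begin

abbreviation unit_interval :: "real topology" where
  "unit_interval \<equiv> top_of_set {0..1}"

section \<open>Free cofibrations\<close>

definition homotopy_extension_property ::
    "'a topology \<Rightarrow> 'x topology \<Rightarrow> ('a \<Rightarrow> 'x) \<Rightarrow> 'w topology \<Rightarrow> bool" where
  "homotopy_extension_property A X j W \<longleftrightarrow>
     (\<forall>u G. continuous_map X W u \<longrightarrow>
            continuous_map (prod_topology A unit_interval) W G \<longrightarrow>
            (\<forall>a\<in>topspace A. u (j a) = G (a, 0)) \<longrightarrow>
            (\<exists>H. continuous_map (prod_topology X unit_interval) W H \<and>
                 (\<forall>a\<in>topspace A. \<forall>t\<in>{0..1}. H (j a, t) = G (a, t)) \<and>
                 (\<forall>x\<in>topspace X. H (x, 0) = u x)))"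

text \<open>
  HOL cannot quantify over types inside a formula, so the type carrying the test
  spaces \<open>W\<close> is an explicit parameter. The full property is
  \<open>free_cofibration TYPE('w) A X j\<close> for every type \<open>'w\<close>. By the lemma
  \<open>free_cofibration_any_type\<close> below, this already follows from the single instance
  \<open>free_cofibration TYPE('x + 'a \<times> real) A X j\<close>, because that type carries a copy of
  the mapping cylinder of \<open>j\<close>. So where the property is assumed, this instance stands
  for all types; where it is concluded, \<open>'w\<close> is left as a type variable.
\<close>

definition free_cofibration ::
    "'w itself \<Rightarrow> 'a topology \<Rightarrow> 'x topology \<Rightarrow> ('a \<Rightarrow> 'x) \<Rightarrow> bool" where
  "free_cofibration (_ :: 'w itself) A X j \<longleftrightarrow>
     continuous_map A X j \<and> (\<forall>W :: 'w topology. homotopy_extension_property A X j W)"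

definition closed_free_cofibration ::
    "'w itself \<Rightarrow> 'a topology \<Rightarrow> 'x topology \<Rightarrow> ('a \<Rightarrow> 'x) \<Rightarrow> bool" where
  "closed_free_cofibration w A X j \<longleftrightarrow> free_cofibration w A X j \<and> closed_map A X j"


section \<open>Topological sums and quotients\<close>

text \<open>The library's \<open>sum_topology\<close> needs all summands to live on one type.\<close>

definition binary_sum :: "'a topology \<Rightarrow> 'b topology \<Rightarrow> ('a + 'b) topology" where
  "binary_sum X Y = topology (\<lambda>U. U \<subseteq> topspace X <+> topspace Y \<and>
                                  openin X (Inl -` U) \<and> openin Y (Inr -` U))"

definition quotient_topology :: "'a topology \<Rightarrow> ('a \<Rightarrow> 'b) \<Rightarrow> 'b topology" where
  "quotient_topology X q =
     topology (\<lambda>U. U \<subseteq> q ` topspace X \<and> openin X {x \<in> topspace X. q x \<in> U})"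

text \<open>The class of \<open>x\<close> under the equivalence relation generated by \<open>r\<close>.\<close>

definition quotient_class :: "('a \<Rightarrow> 'a \<Rightarrow> bool) \<Rightarrow> 'a \<Rightarrow> 'a set" where
  "quotient_class r x = {y. equivclp r x y}"

definition quotient_space :: "'a topology \<Rightarrow> ('a \<Rightarrow> 'a \<Rightarrow> bool) \<Rightarrow> 'a set topology" where
  "quotient_space X r = quotient_topology X (quotient_class r)"

text \<open>
  The map of quotients induced by \<open>h\<close>: the union runs over equal classes whenever
  \<open>h\<close> respects the relations, see \<open>quotient_induced_class\<close>.
\<close>

definition quotient_induced :: "('b \<Rightarrow> 'b \<Rightarrow> bool) \<Rightarrow> ('a \<Rightarrow> 'b) \<Rightarrow> 'a set \<Rightarrow> 'b set" where
  "quotient_induced s h c = (\<Union>z\<in>c. quotient_class s (h z))"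


section \<open>Pointed cones and pointed mapping cones\<close>

definition cone_rel :: "'x topology \<Rightarrow> 'x \<Rightarrow> 'x \<times> real \<Rightarrow> 'x \<times> real \<Rightarrow> bool" where
  "cone_rel X x0 p q \<longleftrightarrow>
     p \<in> {x0} \<times> {0..1} \<union> topspace X \<times> {1} \<and> q \<in> {x0} \<times> {0..1} \<union> topspace X \<times> {1}"

definition cone :: "'x topology \<Rightarrow> 'x \<Rightarrow> ('x \<times> real) set topology" where
  "cone X x0 = quotient_space (prod_topology X unit_interval) (cone_rel X x0)"

definition cone_point :: "'x topology \<Rightarrow> 'x \<Rightarrow> 'x \<Rightarrow> real \<Rightarrow> ('x \<times> real) set" where
  "cone_point X x0 x t = quotient_class (cone_rel X x0) (x, t)"

definition cone_map ::
    "'x topology \<Rightarrow> 'x \<Rightarrow> ('a \<Rightarrow> 'x) \<Rightarrow> ('a \<times> real) set \<Rightarrow> ('x \<times> real) set" where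
  "cone_map X x0 j = quotient_induced (cone_rel X x0) (\<lambda>(a, t). (j a, t))"

definition mapping_cone_rel ::
    "'x topology \<Rightarrow> 'x \<Rightarrow> ('x \<Rightarrow> 'y) \<Rightarrow> 'y + ('x \<times> real) set \<Rightarrow> 'y + ('x \<times> real) set \<Rightarrow> bool" where
  "mapping_cone_rel X x0 f p q \<longleftrightarrow>
     (\<exists>x\<in>topspace X. p = Inl (f x) \<and> q = Inr (cone_point X x0 x 0))"

definition mapping_cone ::
    "'y topology \<Rightarrow> 'x topology \<Rightarrow> 'x \<Rightarrow> ('x \<Rightarrow> 'y) \<Rightarrow> ('y + ('x \<times> real) set) set topology" where
  "mapping_cone Y X x0 f =
     quotient_space (binary_sum Y (cone X x0)) (mapping_cone_rel X x0 f)"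

text \<open>
  The map from the mapping cone of \<open>f \<circ> j\<close> to that of \<open>f\<close> which is the identity on \<open>Y\<close>
  and \<open>cone_map X x0 j\<close> on the cone of \<open>A\<close>.
\<close>

definition mapping_cone_map ::
    "'x topology \<Rightarrow> 'x \<Rightarrow> ('x \<Rightarrow> 'y) \<Rightarrow> ('a \<Rightarrow> 'x) \<Rightarrow>
     ('y + ('a \<times> real) set) set \<Rightarrow> ('y + ('x \<times> real) set) set" where
  "mapping_cone_map X x0 f j =
     quotient_induced (mapping_cone_rel X x0 f) (map_sum id (cone_map X x0 j))"


section \<open>Basic facts\<close>

lemma openin_binary_sum:
  "openin (binary_sum X Y) U \<longleftrightarrow>
     U \<subseteq> topspace X <+> topspace Y \<and> openin X (Inl -` U) \<and> openin Y (Inr -` U)"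
proof -
  have "istopology (\<lambda>U. U \<subseteq> topspace X <+> topspace Y \<and>
                        openin X (Inl -` U) \<and> openin Y (Inr -` U))"
    unfolding istopology_def by (auto simp: vimage_Union)
  then show ?thesis
    by (simp add: binary_sum_def)
qed

lemma topspace_binary_sum [simp]: "topspace (binary_sum X Y) = topspace X <+> topspace Y"
proof -
  have "Inl -` (topspace X <+> topspace Y) = topspace X"
    and "Inr -` (topspace X <+> topspace Y) = topspace Y"
    by auto
  then have "openin (binary_sum X Y) (topspace X <+> topspace Y)"
    by (simp add: openin_binary_sum)
  then show ?thesis
    by (meson openin_binary_sum openin_subset openin_topspace subset_antisym)
qed

lemma continuous_map_from_binary_sum:
  "continuous_map (binary_sum X Y) Z h \<longleftrightarrow>
     continuous_map X Z (h \<circ> Inl) \<and> continuous_map Y Z (h \<circ> Inr)"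
proof -
  have "Inl -` {z \<in> topspace X <+> topspace Y. h z \<in> U} = {x \<in> topspace X. h (Inl x) \<in> U}"
    "Inr -` {z \<in> topspace X <+> topspace Y. h z \<in> U} = {y \<in> topspace Y. h (Inr y) \<in> U}" for U
    by auto
  then have 1: "openin (binary_sum X Y) {z \<in> topspace (binary_sum X Y). h z \<in> U} \<longleftrightarrow>
      openin X {x \<in> topspace X. (h \<circ> Inl) x \<in> U} \<and>
      openin Y {y \<in> topspace Y. (h \<circ> Inr) y \<in> U}" for U
    by (simp add: openin_binary_sum Collect_restrict)
  have 2: "h ` topspace (binary_sum X Y) \<subseteq> topspace Z \<longleftrightarrow>
      (h \<circ> Inl) ` topspace X \<subseteq> topspace Z \<and> (h \<circ> Inr) ` topspace Y \<subseteq> topspace Z"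
    by (simp add: Plus_def image_Un image_comp)
  show ?thesis
    unfolding continuous_map 1 2 by (simp only: all_conj_distrib imp_conjR conj_ac)
qed

lemma openin_quotient_topology:
  "openin (quotient_topology X q) U \<longleftrightarrow>
     U \<subseteq> q ` topspace X \<and> openin X {x \<in> topspace X. q x \<in> U}"
proof -
  have "istopology (\<lambda>U. U \<subseteq> q ` topspace X \<and> openin X {x \<in> topspace X. q x \<in> U})"
    unfolding istopology_def
  proof (intro conjI allI impI)
    fix S T
    assume "S \<subseteq> q ` topspace X \<and> openin X {x \<in> topspace X. q x \<in> S}"
      and "T \<subseteq> q ` topspace X \<and> openin X {x \<in> topspace X. q x \<in> T}"
    moreover have "{x \<in> topspace X. q x \<in> S \<inter> T} =
        {x \<in> topspace X. q x \<in> S} \<inter> {x \<in> topspace X. q x \<in> T}"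
      by auto
    ultimately show "S \<inter> T \<subseteq> q ` topspace X" "openin X {x \<in> topspace X. q x \<in> S \<inter> T}"
      by auto
  next
    fix \<K>
    assume \<K>: "\<forall>K\<in>\<K>. K \<subseteq> q ` topspace X \<and> openin X {x \<in> topspace X. q x \<in> K}"
    have "{x \<in> topspace X. q x \<in> \<Union>\<K>} = (\<Union>K\<in>\<K>. {x \<in> topspace X. q x \<in> K})"
      by auto
    with \<K> show "\<Union>\<K> \<subseteq> q ` topspace X" "openin X {x \<in> topspace X. q x \<in> \<Union>\<K>}"
      by auto
  qed
  then show ?thesis
    by (simp add: quotient_topology_def)
qed

lemma topspace_quotient_topology [simp]: "topspace (quotient_topology X q) = q ` topspace X"
proof -
  have "{x \<in> topspace X. q x \<in> q ` topspace X} = topspace X"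
    by auto
  then have "openin (quotient_topology X q) (q ` topspace X)"
    by (simp add: openin_quotient_topology)
  then show ?thesis
    by (meson openin_quotient_topology openin_subset openin_topspace subset_antisym)
qed

lemma quotient_map_quotient_topology: "quotient_map X (quotient_topology X q) q"
  by (simp add: quotient_map_def openin_quotient_topology)

lemma quotient_induced_class:
  assumes "\<And>x y. r x y \<Longrightarrow> s (h x) (h y)"
  shows "quotient_induced s h (quotient_class r x) = quotient_class s (h x)"
proof -
  have "equivclp s (h x) (h y)" if "equivclp r x y" for y
    using that
  proof (induction rule: equivclp_induct)
    case base
    then show ?case by simp
  next
    case (step y z)
    then have "equivclp s (h y) (h z)"
      using assms by blast
    with step.IH show ?case
      by (rule equivclp_trans)
  qed
  then have eq: "quotient_class s (h y) = quotient_class s (h x)" if "y \<in> quotient_class r x" for y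
    using that unfolding quotient_class_def
    by (auto intro: equivclp_trans equivclp_sym)
  have "quotient_induced s h (quotient_class r x) =
      (\<Union>z\<in>quotient_class r x. quotient_class s (h x))"
    unfolding quotient_induced_def by (rule SUP_cong[OF refl]) (rule eq)
  moreover have "quotient_class r x \<noteq> {}"
    unfolding quotient_class_def using equivclp_refl by fast
  ultimately show ?thesis
    by simp
qed

lemma cone_map_cone_point:
  assumes "j \<in> topspace A \<rightarrow> topspace X" "j a0 = x0"
  shows "cone_map X x0 j (cone_point A a0 a t) = cone_point X x0 (j a) t"
proof -
  have "cone_rel X x0 (case p of (a, t) \<Rightarrow> (j a, t)) (case q of (a, t) \<Rightarrow> (j a, t))"
    if "cone_rel A a0 p q" for p q
    using that assms unfolding cone_rel_def by auto
  then show ?thesis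
    unfolding cone_map_def cone_point_def by (subst quotient_induced_class) auto
qed

lemma mapping_cone_map_class:
  assumes "j \<in> topspace A \<rightarrow> topspace X" "j a0 = x0"
  shows "mapping_cone_map X x0 f j (quotient_class (mapping_cone_rel A a0 (f \<circ> j)) (Inl y)) =
           quotient_class (mapping_cone_rel X x0 f) (Inl y)"
    and "mapping_cone_map X x0 f j
             (quotient_class (mapping_cone_rel A a0 (f \<circ> j)) (Inr (cone_point A a0 a t))) =
           quotient_class (mapping_cone_rel X x0 f) (Inr (cone_point X x0 (j a) t))"
proof -
  have *: "mapping_cone_rel X x0 f (map_sum id (cone_map X x0 j) p) (map_sum id (cone_map X x0 j) q)"
    if "mapping_cone_rel A a0 (f \<circ> j) p q" for p q
  proof -
    from that obtain a where "a \<in> topspace A"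
      and "p = Inl (f (j a))" "q = Inr (cone_point A a0 a 0)"
      by (auto simp: mapping_cone_rel_def)
    then show ?thesis
      using assms(1) cone_map_cone_point[OF assms] by (auto simp: mapping_cone_rel_def)
  qed
  have **: "mapping_cone_map X x0 f j (quotient_class (mapping_cone_rel A a0 (f \<circ> j)) z) =
      quotient_class (mapping_cone_rel X x0 f) (map_sum id (cone_map X x0 j) z)" for z
    unfolding mapping_cone_map_def by (rule quotient_induced_class) (rule *)
  show "mapping_cone_map X x0 f j (quotient_class (mapping_cone_rel A a0 (f \<circ> j)) (Inl y)) =
           quotient_class (mapping_cone_rel X x0 f) (Inl y)"
    by (simp add: **)
  show "mapping_cone_map X x0 f j
             (quotient_class (mapping_cone_rel A a0 (f \<circ> j)) (Inr (cone_point A a0 a t))) =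
           quotient_class (mapping_cone_rel X x0 f) (Inr (cone_point X x0 (j a) t))"
    by (simp add: ** cone_map_cone_point[OF assms])
qed


section \<open>Independence of the type of test spaces\<close>

lemma free_cofibration_any_type:
  fixes A :: "'a topology" and X :: "'x topology"
  assumes "free_cofibration TYPE('x + 'a \<times> real) A X j"
  shows "free_cofibration TYPE('w) A X j"
  unfolding free_cofibration_def
proof (intro conjI allI)
  show j: "continuous_map A X j"
    using assms by (simp add: free_cofibration_def)
  define AI where "AI = prod_topology A unit_interval"
  define q :: "'x + 'a \<times> real \<Rightarrow> 'x + 'a \<times> real" where
    "q = case_sum Inl (\<lambda>(a, t). if t = 0 then Inl (j a) else Inr (a, t))"
  define M where "M = quotient_topology (binary_sum X AI) q"
  have qM: "quotient_map (binary_sum X AI) M q"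
    unfolding M_def by (rule quotient_map_quotient_topology)
  then have q: "continuous_map X M (q \<circ> Inl)" "continuous_map AI M (q \<circ> Inr)"
    using quotient_imp_continuous_map continuous_map_from_binary_sum by blast+
  have "homotopy_extension_property A X j M"
    using assms by (simp add: free_cofibration_def)
  moreover have "\<forall>a\<in>topspace A. (q \<circ> Inl) (j a) = (q \<circ> Inr) (a, 0)"
    by (simp add: q_def)
  ultimately have "\<exists>R. continuous_map (prod_topology X unit_interval) M R \<and>
      (\<forall>a\<in>topspace A. \<forall>t\<in>{0..1}. R (j a, t) = (q \<circ> Inr) (a, t)) \<and>
      (\<forall>x\<in>topspace X. R (x, 0) = (q \<circ> Inl) x)"
    using q unfolding homotopy_extension_property_def AI_def by blast
  then obtain R where R: "continuous_map (prod_topology X unit_interval) M R"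
      "\<And>a t. a \<in> topspace A \<Longrightarrow> 0 \<le> t \<Longrightarrow> t \<le> 1 \<Longrightarrow> R (j a, t) = q (Inr (a, t))"
      "\<And>x. x \<in> topspace X \<Longrightarrow> R (x, 0) = q (Inl x)"
    by auto
  fix W :: "'w topology"
  show "homotopy_extension_property A X j W"
    unfolding homotopy_extension_property_def
  proof (intro allI impI)
    fix u G
    assume u: "continuous_map X W u"
      and G: "continuous_map (prod_topology A unit_interval) W G"
      and uG: "\<forall>a\<in>topspace A. u (j a) = G (a, 0)"
    have "continuous_map (binary_sum X AI) W (case_sum u G)"
      using u G by (simp add: continuous_map_from_binary_sum AI_def o_def)
    then have "continuous_map (binary_sum X AI) W (case_sum u G \<circ> q)"
      by (rule continuous_map_eq) (use uG in \<open>auto simp: q_def AI_def\<close>)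
    then have k: "continuous_map M W (case_sum u G)"
      using continuous_compose_quotient_map_eq[OF qM] by blast
    show "\<exists>H. continuous_map (prod_topology X unit_interval) W H \<and>
              (\<forall>a\<in>topspace A. \<forall>t\<in>{0..1}. H (j a, t) = G (a, t)) \<and>
              (\<forall>x\<in>topspace X. H (x, 0) = u x)"
    proof (intro exI conjI ballI)
      show "continuous_map (prod_topology X unit_interval) W (case_sum u G \<circ> R)"
        using R(1) k by (rule continuous_map_compose)
    qed (use uG in \<open>auto simp: R q_def\<close>)
  qed
qed

end

theory Submission
  imports Defs
begin

text \<open>
  The mapping cone of \<open>f\<close> is a quotient of \<open>Y + X \<times> I\<close>. Since the inclusion of \<open>Y\<close> is covered by
  the identity, an extension problem for mapping cones prescribes the homotopy on \<open>Y\<close> and hence,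
  on \<open>X \<times> I \<times> I\<close>, over both ends of the cone coordinate; what remains is to extend from
  \<open>A \<times> I \<times> I\<close> and from \<open>X \<times> (I \<times> {0} \<union> {0, 1} \<times> I)\<close>. A homeomorphism of the square onto its image
  that carries \<open>I \<times> {0} \<union> {0, 1} \<times> I\<close> into \<open>I \<times> {0}\<close> turns this into the homotopy extension
  property of \<open>j \<times> 1\<close>, which holds because \<open>X \<times> I\<close> maps to the mapping cylinder of \<open>j\<close> by a
  retraction and the product of a quotient map with \<open>I\<close> is again a quotient map. The extension is
  compatible with the identifications at \<open>x0\<close> since \<open>x0 = j a0\<close>. For closedness, a free cofibration
  is injective, so \<open>j \<times> 1\<close> is closed when \<open>j\<close> is.
\<close>

section \<open>Products of cofibrations with locally compact spaces\<close>

lemma free_cofibration_imp_inj_on: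
  assumes "free_cofibration TYPE(bool) A X j"
  shows "inj_on j (topspace A)"
proof (rule inj_onI)
  fix a b
  assume ab: "a \<in> topspace A" "b \<in> topspace A" "j a = j b"
  \<comment> \<open>With the indiscrete space of two points as test space, homotopies are arbitrary functions.\<close>
  define W :: "bool topology" where "W = pullback_topology UNIV (\<lambda>_. ()) (discrete_topology UNIV)"
  have W: "continuous_map Z W h" for Z :: "'z topology" and h
    unfolding W_def by (rule continuous_map_pullback') (auto simp: o_def)
  have topW: "topspace W = UNIV"
    by (simp add: W_def topspace_pullback_topology)
  have "homotopy_extension_property A X j W"
    using assms by (simp add: free_cofibration_def)
  \<comment> \<open>The homotopy is \<open>False\<close> at time 0, like the constant map it has to
    start from, and at every positive time it is the indicator function of \<open>a\<close>. An
    extension thus separates \<open>j a\<close> from \<open>j b\<close> at time 1 unless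
    \<open>a = b\<close>.\<close>
  note this[unfolded homotopy_extension_property_def, THEN spec[of _ "\<lambda>_. False"],
      THEN spec[of _ "\<lambda>(c, t). t \<noteq> 0 \<and> c = a"]]
  then obtain H where "\<forall>c\<in>topspace A. \<forall>t\<in>{0..1}. H (j c, t) = (t \<noteq> (0::real) \<and> c = a)"
    by (auto simp: W topW)
  then have "H (j a, 1) \<longleftrightarrow> a = a" "H (j b, 1) \<longleftrightarrow> b = a"
    using ab(1,2) by simp_all
  with ab(3) show "a = b"
    by metis
qed

section \<open>Homotopy extension after multiplication by a locally compact Hausdorff space\<close>

lemma vimage_image_sum:
  "Inl -` Inl ` V = V" "Inr -` Inl ` V = {}" "Inr -` Inr ` V' = V'" "Inl -` Inr ` V' = {}"
  by auto

text \<open>Products distribute over sums: the injections are open, so an open rectangle inside the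
  preimage over one summand is carried to an open rectangle of the sum times
  \<open>Z\<close>.\<close>

lemma continuous_map_from_binary_sum_times:
  assumes Inl: "continuous_map (prod_topology X Z) W (\<lambda>(x, z). h (Inl x, z))"
    and Inr: "continuous_map (prod_topology Y Z) W (\<lambda>(y, z). h (Inr y, z))"
  shows "continuous_map (prod_topology (binary_sum X Y) Z) W h"
  unfolding continuous_map
proof (intro conjI allI impI)
  have "h (p, z) \<in> topspace W" if "p \<in> topspace X <+> topspace Y" "z \<in> topspace Z" for p z
    using that Inl Inr by (fastforce simp: continuous_map_def Pi_iff)
  then show "h ` topspace (prod_topology (binary_sum X Y) Z) \<subseteq> topspace W"
    by auto
  fix U
  assume U: "openin W U"
  let ?S = "{p \<in> topspace (prod_topology (binary_sum X Y) Z). h p \<in> U}"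
  have iX: "openin (prod_topology X Z) {p \<in> topspace (prod_topology X Z). h (Inl (fst p), snd p) \<in> U}"
    using openin_continuous_map_preimage[OF Inl U] by (simp add: case_prod_unfold)
  have iY: "openin (prod_topology Y Z) {p \<in> topspace (prod_topology Y Z). h (Inr (fst p), snd p) \<in> U}"
    using openin_continuous_map_preimage[OF Inr U] by (simp add: case_prod_unfold)
  have "\<exists>V V'. openin (binary_sum X Y) V \<and> openin Z V' \<and> p \<in> V \<and> z \<in> V' \<and> V \<times> V' \<subseteq> ?S"
    if "(p, z) \<in> ?S" for p z
  proof (cases p)
    case (Inl x)
    with that have "(x, z) \<in> {p \<in> topspace (prod_topology X Z). h (Inl (fst p), snd p) \<in> U}"
      by auto
    then obtain V V' where "openin X V" "openin Z V'" "x \<in> V" "z \<in> V'"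
      and sub: "V \<times> V' \<subseteq> {p \<in> topspace (prod_topology X Z). h (Inl (fst p), snd p) \<in> U}"
      using iX[unfolded openin_prod_topology_alt] by meson
    moreover have "openin (binary_sum X Y) (Inl ` V)"
      using openin_subset[OF \<open>openin X V\<close>] \<open>openin X V\<close>
      by (auto simp: openin_binary_sum vimage_image_sum)
    ultimately show ?thesis
      using Inl sub by (intro exI[of _ "Inl ` V"] exI[of _ V']) auto
  next
    case (Inr y)
    with that have "(y, z) \<in> {p \<in> topspace (prod_topology Y Z). h (Inr (fst p), snd p) \<in> U}"
      by auto
    then obtain V V' where "openin Y V" "openin Z V'" "y \<in> V" "z \<in> V'"
      and sub: "V \<times> V' \<subseteq> {p \<in> topspace (prod_topology Y Z). h (Inr (fst p), snd p) \<in> U}"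
      using iY[unfolded openin_prod_topology_alt] by meson
    moreover have "openin (binary_sum X Y) (Inr ` V)"
      using openin_subset[OF \<open>openin Y V\<close>] \<open>openin Y V\<close>
      by (auto simp: openin_binary_sum vimage_image_sum)
    ultimately show ?thesis
      using Inr sub by (intro exI[of _ "Inr ` V"] exI[of _ V']) auto
  qed
  then show "openin (prod_topology (binary_sum X Y) Z) ?S"
    unfolding openin_prod_topology_alt by blast
qed

lemma continuous_map_prod_swap_right:
  "continuous_map (prod_topology (prod_topology X Y) Z) (prod_topology (prod_topology X Z) Y)
     (\<lambda>p. ((fst (fst p), snd p), snd (fst p)))"
proof (intro continuous_map_pairedI continuous_map_snd)
  show "continuous_map (prod_topology (prod_topology X Y) Z) X (\<lambda>p. fst (fst p))"
    using continuous_map_compose[OF continuous_map_fst continuous_map_fst] by (simp add: o_def)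
  show "continuous_map (prod_topology (prod_topology X Y) Z) Y (\<lambda>p. snd (fst p))"
    using continuous_map_compose[OF continuous_map_fst continuous_map_snd] by (simp add: o_def)
qed

text \<open>\<open>R\<close> solves the universal extension problem, whose target is the mapping
  cylinder. Every problem over \<open>X \<times> Z\<close> is then solved by composing
  \<open>R \<times> 1\<close> with the map that \<open>u\<close> and \<open>G\<close> induce on the
  cylinder times \<open>Z\<close>.\<close>

lemma homotopy_extension_property_times:
  fixes A :: "'a topology" and X :: "'x topology" and Z :: "'z topology" and W :: "'w topology"
  assumes j: "free_cofibration TYPE('x + 'a \<times> real) A X j"
    and Z: "locally_compact_space Z" "Hausdorff_space Z"
  shows "homotopy_extension_property (prod_topology A Z) (prod_topology X Z) (\<lambda>(a, z). (j a, z)) W"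
proof -
  define AI where "AI = prod_topology A unit_interval"
  \<comment> \<open>\<open>M\<close> is the mapping cylinder with its points encoded by
    representatives in the sum: only \<open>(a, 0)\<close> is moved, to \<open>j a\<close>. Hence
    \<open>M\<close> lives on the very type for which the cofibration property is assumed.\<close>
  define q :: "'x + 'a \<times> real \<Rightarrow> 'x + 'a \<times> real" where
    "q = case_sum Inl (\<lambda>(a, t). if t = 0 then Inl (j a) else Inr (a, t))"
  define M where "M = quotient_topology (binary_sum X AI) q"
  have qM: "quotient_map (binary_sum X AI) M q"
    unfolding M_def by (rule quotient_map_quotient_topology)
  then have q: "continuous_map X M (q \<circ> Inl)" "continuous_map AI M (q \<circ> Inr)"
    using quotient_imp_continuous_map continuous_map_from_binary_sum by blast+
  have "homotopy_extension_property A X j M"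
    using j by (simp add: free_cofibration_def)
  moreover have "\<forall>a\<in>topspace A. (q \<circ> Inl) (j a) = (q \<circ> Inr) (a, 0)"
    by (simp add: q_def)
  ultimately have "\<exists>R. continuous_map (prod_topology X unit_interval) M R \<and>
      (\<forall>a\<in>topspace A. \<forall>t\<in>{0..1}. R (j a, t) = (q \<circ> Inr) (a, t)) \<and>
      (\<forall>x\<in>topspace X. R (x, 0) = (q \<circ> Inl) x)"
    using q unfolding homotopy_extension_property_def AI_def by blast
  then obtain R where R: "continuous_map (prod_topology X unit_interval) M R"
      "\<And>a t. a \<in> topspace A \<Longrightarrow> 0 \<le> t \<Longrightarrow> t \<le> 1 \<Longrightarrow> R (j a, t) = q (Inr (a, t))"
      "\<And>x. x \<in> topspace X \<Longrightarrow> R (x, 0) = q (Inl x)"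
    by auto
  \<comment> \<open>Local compactness and the Hausdorff property of \<open>Z\<close> enter here:
    multiplication by such a space preserves quotient maps.\<close>
  have qMZ: "quotient_map (prod_topology (binary_sum X AI) Z) (prod_topology M Z) (\<lambda>(p, z). (q p, z))"
    using Z qM by (intro quotient_map_prod_left) auto
  show ?thesis
    unfolding homotopy_extension_property_def
  proof (intro allI impI)
    fix u G
    assume u: "continuous_map (prod_topology X Z) W u"
      and G: "continuous_map (prod_topology (prod_topology A Z) unit_interval) W G"
      and uG: "\<forall>a\<in>topspace (prod_topology A Z). u (case a of (a, z) \<Rightarrow> (j a, z)) = G (a, 0)"
    define F where "F = (\<lambda>(p, z). case p of Inl x \<Rightarrow> u (x, z) | Inr (a, t) \<Rightarrow> G ((a, z), t))"
    have shuffle: "continuous_map (prod_topology AI Z) (prod_topology (prod_topology A Z) unit_interval)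
        (\<lambda>p. ((fst (fst p), snd p), snd (fst p)))"
      unfolding AI_def by (rule continuous_map_prod_swap_right)
    have "continuous_map (prod_topology (binary_sum X AI) Z) W F"
    proof (rule continuous_map_from_binary_sum_times)
      show "continuous_map (prod_topology X Z) W (\<lambda>(x, z). F (Inl x, z))"
        using u by (simp add: F_def)
      show "continuous_map (prod_topology AI Z) W (\<lambda>(y, z). F (Inr y, z))"
        using continuous_map_compose[OF shuffle G] by (simp add: F_def o_def case_prod_unfold)
    qed
    \<comment> \<open>Since \<open>q\<close> takes values in the sum type, \<open>F\<close> is also
      a function on \<open>M \<times> Z\<close>. By \<open>uG\<close> it is unchanged by
      \<open>q\<close>, so it descends as it stands.\<close>
    then have "continuous_map (prod_topology (binary_sum X AI) Z) W (F \<circ> (\<lambda>(p, z). (q p, z)))"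
      by (rule continuous_map_eq) (use uG in \<open>auto simp: F_def q_def AI_def\<close>)
    then have F: "continuous_map (prod_topology M Z) W F"
      using continuous_compose_quotient_map_eq[OF qMZ] by blast
    have shuffle: "continuous_map (prod_topology (prod_topology X Z) unit_interval)
        (prod_topology (prod_topology X unit_interval) Z) (\<lambda>p. ((fst (fst p), snd p), snd (fst p)))"
      by (rule continuous_map_prod_swap_right)
    have "continuous_map (prod_topology (prod_topology X unit_interval) Z) (prod_topology M Z)
        (\<lambda>(p, z). (R p, z))"
      using R(1) by (simp add: continuous_map_prod_top)
    from continuous_map_compose[OF continuous_map_compose[OF shuffle this] F]
    have "continuous_map (prod_topology (prod_topology X Z) unit_interval) W
        (\<lambda>((x, z), t). F (R (x, t), z))"
      by (simp add: o_def case_prod_unfold)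
    then show "\<exists>H. continuous_map (prod_topology (prod_topology X Z) unit_interval) W H \<and>
        (\<forall>a\<in>topspace (prod_topology A Z). \<forall>t\<in>{0..1}. H (case a of (a, z) \<Rightarrow> (j a, z), t) = G (a, t)) \<and>
        (\<forall>x\<in>topspace (prod_topology X Z). H (x, 0) = u x)"
      using uG by (intro exI conjI) (assumption, auto simp: R F_def q_def)
  qed
qed

section \<open>Homotopies on a cylinder with prescribed ends\<close>

text \<open>
  Central projection from the point \<open>(1/2, 2)\<close> above the unit square: the first coordinate of
  \<open>square_fold\<close> is the slope of the ray, the second the depth below \<open>I \<times> {0} \<union> {0, 1} \<times> I\<close>.
  The image of \<open>square_fold\<close> is a proper subset of the square, so \<open>square_unfold\<close> is only a left inverse,
  and its clamping \<open>max 1\<close> keeps its values in the square.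
\<close>

definition square_fold :: "real \<times> real \<Rightarrow> real \<times> real" where
  "square_fold = (\<lambda>(s, t). ((1 + (2 * s - 1) / (2 - t)) / 2, 1 - max ((2 - t) / 2) \<bar>2 * s - 1\<bar>))"

definition square_unfold :: "real \<times> real \<Rightarrow> real \<times> real" where
  "square_unfold = (\<lambda>(p, d). let r = max 1 ((1 - d) / max (1/2) \<bar>2 * p - 1\<bar>)
                             in ((1 + (2 * p - 1) * r) / 2, 2 - r))"

section \<open>Folding three sides of the square into the bottom edge\<close>

text \<open>With \<open>c = 2 * s - 1\<close> and \<open>r = 2 - t\<close>, measured from the centre
  of projection, folding records the slope \<open>c / r\<close> and the number
  \<open>max (r / 2) \<bar>c\<bar> = r * max (1/2) \<bar>c / r\<bar>\<close>. Dividing the second by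
  \<open>max (1/2)\<close> of the absolute slope recovers \<open>r\<close>, and the clamp is
  inactive as \<open>1 \<le> r\<close>.\<close>

lemma square_unfold_fold:
  assumes "0 \<le> s" "s \<le> 1" "0 \<le> t" "t \<le> 1"
  shows "square_unfold (square_fold (s, t)) = (s, t)"
proof -
  define r where "r = 2 - t"
  define c where "c = 2 * s - 1"
  have r: "1 \<le> r" "r \<le> 2" and c: "\<bar>c\<bar> \<le> 1" and s: "s = (1 + c) / 2" and t: "t = 2 - r"
    using assms by (auto simp: r_def c_def)
  have "max (r / 2) \<bar>c\<bar> = r * max (1 / 2) \<bar>c / r\<bar>"
    using r by (simp add: max_mult_distrib_left)
  moreover have "max (1 / 2) \<bar>c / r\<bar> \<noteq> 0"
    by (metis less_max_iff_disj less_irrefl zero_less_divide_1_iff zero_less_numeral)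
  ultimately have "max (r / 2) \<bar>c\<bar> / max (1 / 2) \<bar>c / r\<bar> = r"
    by (metis nonzero_mult_div_cancel_right)
  moreover have "square_fold (s, t) = ((1 + c / r) / 2, 1 - max (r / 2) \<bar>c\<bar>)"
    by (simp add: square_fold_def r_def c_def)
  moreover have "2 * ((1 + k) / 2) - 1 = k" for k :: real
    by (simp add: field_simps)
  ultimately show ?thesis
    using r by (simp only: square_unfold_def prod.case Let_def) (simp add: s t)
qed

lemma abs_le_one_iff: "\<bar>x\<bar> \<le> (1::real) \<longleftrightarrow> -1 \<le> x \<and> x \<le> 1"
  by linarith

lemma continuous_map_square_fold:
  "continuous_map (prod_topology unit_interval unit_interval) (prod_topology unit_interval unit_interval)
     square_fold"
proof -
  have "square_fold (s, t) \<in> {0..1} \<times> {0..1}" if "s \<in> {0..1}" "t \<in> {0..1}" for s t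
  proof -
    have "\<bar>2 * s - 1\<bar> \<le> 1"
      using that by auto
    then have "\<bar>(2 * s - 1) / (2 - t)\<bar> \<le> 1"
      using that by (simp add: divide_le_eq_1)
    then have "-1 \<le> (2 * s - 1) / (2 - t)" "(2 * s - 1) / (2 - t) \<le> 1"
      unfolding abs_le_one_iff by blast+
    then show ?thesis
      using that by (simp add: square_fold_def max_def abs_le_one_iff)
  qed
  moreover have "continuous_on ({0..1} \<times> {0..1}) square_fold"
    unfolding square_fold_def case_prod_unfold by (intro continuous_intros) auto
  ultimately show ?thesis
    by auto
qed

text \<open>A homotopy will be pulled back along \<open>square_unfold\<close> to the full square, so
  points off the image of \<open>square_fold\<close> count too. The clamp gives
  \<open>1 \<le> r\<close>, the lower bound 1/2 of the denominator gives \<open>r \<le> 2\<close>,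
  and slope times \<open>r\<close> stays in \<open>[-1, 1]\<close> because the denominator dominates
  the slope.\<close>

lemma continuous_map_square_unfold:
  "continuous_map (prod_topology unit_interval unit_interval) (prod_topology unit_interval unit_interval)
     square_unfold"
proof -
  have "square_unfold (p, d) \<in> {0..1} \<times> {0..1}" if "p \<in> {0..1}" "d \<in> {0..1}" for p d
  proof -
    define r where "r = max 1 ((1 - d) / max (1/2) \<bar>2 * p - 1\<bar>)"
    have m: "max (1/2) \<bar>2 * p - 1\<bar> > 0"
      by simp
    have "(1 - d) / max (1/2) \<bar>2 * p - 1\<bar> \<le> 1 / (1/2)"
      using that by (intro frac_le) auto
    then have r: "1 \<le> r" "r \<le> 2"
      by (auto simp: r_def)
    have "\<bar>2 * p - 1\<bar> * ((1 - d) / max (1/2) \<bar>2 * p - 1\<bar>) \<le> 1"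
    proof -
      have "\<bar>2 * p - 1\<bar> * (1 - d) \<le> max (1/2) \<bar>2 * p - 1\<bar> * 1"
        using that by (intro mult_mono) auto
      then show ?thesis
        using m by (simp add: divide_le_eq)
    qed
    moreover have "\<bar>2 * p - 1\<bar> \<le> 1"
      using that by auto
    ultimately have "\<bar>(2 * p - 1) * r\<bar> \<le> 1"
      unfolding abs_mult using r(1) by (auto simp: r_def max_def)
    with r show ?thesis
      by (auto simp: square_unfold_def Let_def abs_le_one_iff simp flip: r_def)
  qed
  moreover have "continuous_on ({0..1} \<times> {0..1}) square_unfold"
    unfolding square_unfold_def case_prod_unfold Let_def by (intro continuous_intros) auto
  ultimately show ?thesis
    by auto
qed

section \<open>Extension relative to both ends of the cylinder\<close>

text \<open>Read through \<open>square_unfold\<close>, the maps \<open>e0\<close>, \<open>u\<close>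
  and \<open>e1\<close> on the left, bottom and right side combine into one initial map
  \<open>v\<close>, and \<open>g\<close> becomes \<open>g \<circ> unf\<close>. \<open>HEP\<close>
  extends these to \<open>K\<close>, and \<open>K \<circ> fol\<close> is as required because
  unfolding undoes folding.\<close>

lemma homotopy_extension_cylinder_rel_ends:
  assumes HEP: "homotopy_extension_property (prod_topology A unit_interval)
      (prod_topology X unit_interval) (\<lambda>(a, s). (j a, s)) W"
    and j: "continuous_map A X j"
    and u: "continuous_map (prod_topology X unit_interval) W u"
    and e0: "continuous_map (prod_topology X unit_interval) W e0"
    and e1: "continuous_map (prod_topology X unit_interval) W e1"
    and g: "continuous_map (prod_topology (prod_topology A unit_interval) unit_interval) W g"
    and u0: "\<And>x. x \<in> topspace X \<Longrightarrow> u (x, 0) = e0 (x, 0)"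
    and u1: "\<And>x. x \<in> topspace X \<Longrightarrow> u (x, 1) = e1 (x, 0)"
    and gu: "\<And>a s. a \<in> topspace A \<Longrightarrow> s \<in> {0..1} \<Longrightarrow> g ((a, s), 0) = u (j a, s)"
    and g0: "\<And>a t. a \<in> topspace A \<Longrightarrow> t \<in> {0..1} \<Longrightarrow> g ((a, 0), t) = e0 (j a, t)"
    and g1: "\<And>a t. a \<in> topspace A \<Longrightarrow> t \<in> {0..1} \<Longrightarrow> g ((a, 1), t) = e1 (j a, t)"
  obtains H where
    "continuous_map (prod_topology (prod_topology X unit_interval) unit_interval) W H"
    "\<And>x s. x \<in> topspace X \<Longrightarrow> s \<in> {0..1} \<Longrightarrow> H ((x, s), 0) = u (x, s)"
    "\<And>x t. x \<in> topspace X \<Longrightarrow> t \<in> {0..1} \<Longrightarrow> H ((x, 0), t) = e0 (x, t)"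
    "\<And>x t. x \<in> topspace X \<Longrightarrow> t \<in> {0..1} \<Longrightarrow> H ((x, 1), t) = e1 (x, t)"
    "\<And>a s t. a \<in> topspace A \<Longrightarrow> s \<in> {0..1} \<Longrightarrow> t \<in> {0..1} \<Longrightarrow> H ((j a, s), t) = g ((a, s), t)"
proof -
  let ?I = unit_interval
  \<comment> \<open>On the bottom edge, \<open>square_unfold (p, 0)\<close> runs through the left, bottom and right side of the
      square for \<open>p \<le> 1/4\<close>, \<open>1/4 \<le> p \<le> 3/4\<close> and \<open>3/4 \<le> p\<close>; its coordinates are \<open>\<sigma>\<close> and \<open>\<tau>\<close>.\<close>
  define \<sigma> where "\<sigma> = (\<lambda>p::real. max 0 (min 1 (2 * p - 1/2)))"
  define \<tau> where "\<tau> = (\<lambda>p::real. 2 - 1 / max (1/2) \<bar>2 * p - 1\<bar>)"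
  \<comment> \<open>At the corners \<open>(0, 0)\<close> and \<open>(1, 0)\<close> the slope
    \<open>(2 * s - 1) / (2 - t)\<close> is -1/2 and 1/2, so they fold to \<open>p = 1/4\<close> and
    \<open>p = 3/4\<close>.\<close>
  define v where "v = (\<lambda>(x, p). if p \<le> 1/4 then e0 (x, \<tau> p)
      else if p \<le> 3/4 then u (x, \<sigma> p) else e1 (x, \<tau> p))"
  define unf where "unf = (\<lambda>((a::'a, p), d). let (s, t) = square_unfold (p, d) in ((a, s), t))"
  define fol where "fol = (\<lambda>((x::'b, s), t). let (p, d) = square_fold (s, t) in ((x, p), d))"
  have assoc: "continuous_map (prod_topology (prod_topology Z ?I) ?I)
      (prod_topology (prod_topology Z ?I) ?I)
      (\<lambda>((z, s), t). let (p, d) = h (s, t) in ((z, p), d))"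
    if "continuous_map (prod_topology ?I ?I) (prod_topology ?I ?I) h" for Z :: "'z topology" and h
  proof -
    let ?Z = "prod_topology (prod_topology Z ?I) ?I"
    have st: "continuous_map ?Z (prod_topology ?I ?I) (\<lambda>p. (snd (fst p), snd p))"
      by (intro continuous_map_pairedI continuous_map_snd
          continuous_map_compose[OF continuous_map_fst continuous_map_snd, unfolded o_def])
    have "continuous_map ?Z ?Z
        (\<lambda>p. ((fst (fst p), fst (h (snd (fst p), snd p))), snd (h (snd (fst p), snd p))))"
      by (intro continuous_map_pairedI
          continuous_map_compose[OF continuous_map_fst continuous_map_fst, unfolded o_def]
          continuous_map_compose[OF continuous_map_compose[OF st that] continuous_map_fst, unfolded o_def]
          continuous_map_compose[OF continuous_map_compose[OF st that] continuous_map_snd, unfolded o_def])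
    then show ?thesis
      by (simp only: case_prod_unfold Let_def)
  qed
  have unf: "continuous_map (prod_topology (prod_topology A ?I) ?I)
      (prod_topology (prod_topology A ?I) ?I) unf"
    unfolding unf_def by (rule assoc) (rule continuous_map_square_unfold)
  have fol: "continuous_map (prod_topology (prod_topology X ?I) ?I)
      (prod_topology (prod_topology X ?I) ?I) fol"
    unfolding fol_def by (rule assoc) (rule continuous_map_square_fold)
  have "\<sigma> p \<in> {0..1}" for p
    by (auto simp: \<sigma>_def)
  moreover have "continuous_on {0..1} \<sigma>"
    unfolding \<sigma>_def by (intro continuous_intros)
  ultimately have \<sigma>: "continuous_map ?I ?I \<sigma>"
    by auto
  have tau_bounds: "\<tau> p \<in> {0..1}" if "p \<in> {0..1}" for p
  proof -
    have "1 / max (1/2) \<bar>2 * p - 1\<bar> \<le> 1 / (1/2)"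
      by (intro frac_le) auto
    moreover have "1 \<le> 1 / max (1/2) \<bar>2 * p - 1\<bar>"
      using that by (simp add: le_divide_eq abs_le_one_iff)
    ultimately show ?thesis
      by (simp add: \<tau>_def)
  qed
  moreover have "continuous_on {0..1} \<tau>"
    unfolding \<tau>_def by (intro continuous_intros) auto
  ultimately have \<tau>: "continuous_map ?I ?I \<tau>"
    by auto
  have reparam: "continuous_map (prod_topology X ?I) W (\<lambda>p. w (fst p, h (snd p)))"
    if w: "continuous_map (prod_topology X ?I) W w" and h: "continuous_map ?I ?I h" for w h
  proof -
    have "continuous_map (prod_topology X ?I) (prod_topology X ?I) (\<lambda>p. (fst p, h (snd p)))"
      by (intro continuous_map_pairedI continuous_map_fst
          continuous_map_compose[OF continuous_map_snd h, unfolded o_def])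
    from continuous_map_compose[OF this w] show ?thesis
      by (simp add: o_def)
  qed
  have snd: "continuous_map (prod_topology X ?I) euclideanreal snd"
    using continuous_map_snd continuous_map_into_fulltopology by blast
  have \<tau>_simps: "\<tau> p = 0" if "p = 1/4 \<or> p = 3/4" for p
    using that by (auto simp: \<tau>_def)
  have \<sigma>_simps: "p = 1/4 \<Longrightarrow> \<sigma> p = 0" "p = 3/4 \<Longrightarrow> \<sigma> p = 1" for p
    by (simp_all add: \<sigma>_def)
  have v_eq: "v = (\<lambda>q. if snd q \<le> 1/4 then e0 (fst q, \<tau> (snd q))
      else if snd q \<le> 3/4 then u (fst q, \<sigma> (snd q)) else e1 (fst q, \<tau> (snd q)))"
    by (auto simp: v_def)
  \<comment> \<open>The three pieces are glued at the two corners, where they agree by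
    \<open>u0\<close> and \<open>u1\<close>.\<close>
  have v: "continuous_map (prod_topology X ?I) W v"
    unfolding v_eq
  proof (intro continuous_map_cases_le continuous_map_from_subtopology snd)
    show "e0 (fst q, \<tau> (snd q)) = (if snd q \<le> 3/4 then u (fst q, \<sigma> (snd q)) else e1 (fst q, \<tau> (snd q)))"
      if "q \<in> topspace (prod_topology X ?I)" "snd q = 1/4" for q
      using that by (auto simp: u0 \<tau>_simps \<sigma>_simps)
    show "u (fst q, \<sigma> (snd q)) = e1 (fst q, \<tau> (snd q))"
      if "q \<in> topspace (subtopology (prod_topology X ?I) S)" "snd q = 3/4" for q S
      using that by (auto simp: u1 \<tau>_simps \<sigma>_simps simp del: Int_iff)
  qed (rule reparam[OF e0 \<tau>] reparam[OF e1 \<tau>] reparam[OF u \<sigma>] | simp)+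
  have gunf: "continuous_map (prod_topology (prod_topology A ?I) ?I) W (g \<circ> unf)"
    using unf g by (rule continuous_map_compose)
  \<comment> \<open>This is the compatibility at time 0 demanded by \<open>HEP\<close>; the cases
    are the sides of the square that \<open>square_unfold (p, 0)\<close> reaches, treated by
    \<open>g0\<close>, \<open>gu\<close> and \<open>g1\<close>.\<close>
  have v_fold: "v (x, p) = (g \<circ> unf) ((a, p), 0)"
    if a: "a \<in> topspace A" "x = j a" and p: "p \<in> {0..1}" for a x p
  proof -
    consider "p \<le> 1/4" | "1/4 < p" "p \<le> 3/4" | "3/4 < p"
      by linarith
    then show ?thesis
    proof cases
      case 1
      then have "square_unfold (p, 0) = (0, \<tau> p)"
        using p by (auto simp: square_unfold_def \<tau>_def Let_def max_def abs_if field_simps)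
      with 1 show ?thesis
        using g0[OF a(1) tau_bounds[OF p]] a(2) by (simp add: v_def unf_def)
    next
      case 2
      then have m: "max (1/2) \<bar>2 * p - 1\<bar> = 1/2"
        by linarith
      with 2 have "square_unfold (p, 0) = (\<sigma> p, 0)" "\<sigma> p \<in> {0..1}"
        unfolding square_unfold_def \<sigma>_def Let_def prod.case m by auto
      with 2 show ?thesis
        using gu[OF a(1), of "\<sigma> p"] a(2) by (simp add: v_def unf_def)
    next
      case 3
      then have m: "max (1/2) \<bar>2 * p - 1\<bar> = 2 * p - 1"
        by linarith
      from 3 p have "max 1 (1 / (2 * p - 1)) = 1 / (2 * p - 1)"
        by simp
      with 3 have "square_unfold (p, 0) = (1, \<tau> p)"
        unfolding square_unfold_def \<tau>_def Let_def prod.case m by simp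
      with 3 show ?thesis
        using g1[OF a(1) tau_bounds[OF p]] a(2) by (simp add: v_def unf_def)
    qed
  qed
  then obtain K where K: "continuous_map (prod_topology (prod_topology X ?I) ?I) W K"
      "\<And>a p d. a \<in> topspace A \<Longrightarrow> p \<in> {0..1} \<Longrightarrow> d \<in> {0..1} \<Longrightarrow> K ((j a, p), d) = (g \<circ> unf) ((a, p), d)"
      "\<And>x p. x \<in> topspace X \<Longrightarrow> p \<in> {0..1} \<Longrightarrow> K ((x, p), 0) = v (x, p)"
  proof -
    have "\<forall>q\<in>topspace (prod_topology A ?I). v (case q of (a, s) \<Rightarrow> (j a, s)) = (g \<circ> unf) (q, 0)"
      using v_fold by auto
    then have "\<exists>K. continuous_map (prod_topology (prod_topology X ?I) ?I) W K \<and>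
        (\<forall>q\<in>topspace (prod_topology A ?I). \<forall>d\<in>{0..1}.
          K (case q of (a, s) \<Rightarrow> (j a, s), d) = (g \<circ> unf) (q, d)) \<and>
        (\<forall>q\<in>topspace (prod_topology X ?I). K (q, 0) = v q)"
      using HEP v gunf unfolding homotopy_extension_property_def by blast
    then show thesis
      by (elim exE conjE) (rule that, auto)
  qed
  show thesis
  proof (rule that)
    show "continuous_map (prod_topology (prod_topology X ?I) ?I) W (K \<circ> fol)"
      using fol K(1) by (rule continuous_map_compose)
  next
    fix x and s :: real
    assume x: "x \<in> topspace X" and s: "s \<in> {0..1}"
    \<comment> \<open>The point of the bottom edge to which \<open>(s, 0)\<close> folds; its depth
      is 0 since \<open>\<bar>2 * s - 1\<bar> \<le> 1\<close>.\<close>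
    define p where "p = (1 + (2 * s - 1) / 2) / 2"
    have "square_fold (s, 0) = (p, 0)"
      using s by (auto simp: square_fold_def p_def)
    moreover have "p \<in> {0..1}" "1/4 \<le> p" "p \<le> 3/4" "\<sigma> p = s"
      using s by (auto simp: p_def \<sigma>_def field_simps)
    moreover have "v (x, p) = u (x, s)"
      \<comment> \<open>At \<open>p = 1/4\<close> the definition of \<open>v\<close> selects
        \<open>e0\<close>, so the corner needs \<open>u0\<close>.\<close>
      using calculation u0[OF x] by (cases "p = 1/4") (auto simp: v_def \<tau>_simps \<sigma>_simps)
    ultimately show "(K \<circ> fol) ((x, s), 0) = u (x, s)"
      using x by (simp add: fol_def K(3))
  next
    fix x and t :: real
    assume x: "x \<in> topspace X" and t: "t \<in> {0..1}"
    define p where "p = (1 - 1 / (2 - t)) / 2"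
    have "square_fold (0, t) = (p, 0)"
      using t by (auto simp: square_fold_def p_def)
    moreover have "p \<in> {0..1}" "p \<le> 1/4" "\<tau> p = t"
      using t by (auto simp: p_def \<tau>_def field_simps max_def)
    ultimately show "(K \<circ> fol) ((x, 0), t) = e0 (x, t)"
      using x by (simp add: fol_def K(3) v_def)
  next
    fix x and t :: real
    assume x: "x \<in> topspace X" and t: "t \<in> {0..1}"
    define p where "p = (1 + 1 / (2 - t)) / 2"
    have "square_fold (1, t) = (p, 0)"
      using t by (auto simp: square_fold_def p_def)
    moreover have "p \<in> {0..1}" "3/4 \<le> p" "\<tau> p = t"
      using t by (auto simp: p_def \<tau>_def field_simps max_def)
    moreover have "v (x, p) = e1 (x, t)"
      \<comment> \<open>At \<open>p = 3/4\<close> the definition of \<open>v\<close> selects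
        \<open>u\<close>, so the corner needs \<open>u1\<close>.\<close>
      using calculation u1[OF x] by (cases "p = 3/4") (auto simp: v_def \<tau>_simps \<sigma>_simps)
    ultimately show "(K \<circ> fol) ((x, 1), t) = e1 (x, t)"
      using x by (simp add: fol_def K(3))
  next
    fix a and s t :: real
    assume a: "a \<in> topspace A" and s: "s \<in> {0..1}" and t: "t \<in> {0..1}"
    obtain p d where pd: "square_fold (s, t) = (p, d)"
      by fastforce
    have "square_fold ` ({0..1} \<times> {0..1}) \<subseteq> {0..1} \<times> {0..1}"
      using continuous_map_image_subset_topspace[OF continuous_map_square_fold] by simp
    then have "square_fold (s, t) \<in> {0..1} \<times> {0..1}"
      using s t by (meson SigmaI image_subset_iff)
    then have "p \<in> {0..1}" "d \<in> {0..1}"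
      using pd by simp_all
    moreover have "square_unfold (p, d) = (s, t)"
      using square_unfold_fold s t pd by (metis atLeastAtMost_iff)
    ultimately show "(K \<circ> fol) ((j a, s), t) = g ((a, s), t)"
      using a by (simp add: fol_def pd K(2) unf_def)
  qed
qed

section \<open>The mapping cone as a quotient of \<open>Y + X \<times> I\<close>\<close>

lemma quotient_map_binary_sum:
  assumes p: "quotient_map X X' p" and q: "quotient_map Y Y' q"
  shows "quotient_map (binary_sum X Y) (binary_sum X' Y') (map_sum p q)"
  unfolding quotient_map_def
proof (intro conjI allI impI)
  have im: "p ` topspace X = topspace X'" "q ` topspace Y = topspace Y'"
    using p q by (auto simp: quotient_map_def)
  show "map_sum p q ` topspace (binary_sum X Y) = topspace (binary_sum X' Y')"
    by (simp add: Plus_def image_Un image_image flip: im)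
  fix U
  assume "U \<subseteq> topspace (binary_sum X' Y')"
  then have U: "U \<subseteq> topspace X' <+> topspace Y'" "Inl -` U \<subseteq> topspace X'" "Inr -` U \<subseteq> topspace Y'"
    by auto
  have "Inl -` {z \<in> topspace X <+> topspace Y. map_sum p q z \<in> U} = {x \<in> topspace X. p x \<in> Inl -` U}"
    "Inr -` {z \<in> topspace X <+> topspace Y. map_sum p q z \<in> U} = {y \<in> topspace Y. q y \<in> Inr -` U}"
    by auto
  moreover have "openin X {x \<in> topspace X. p x \<in> Inl -` U} = openin X' (Inl -` U)"
    "openin Y {y \<in> topspace Y. q y \<in> Inr -` U} = openin Y' (Inr -` U)"
    using p q U unfolding quotient_map_def by blast+
  ultimately show "openin (binary_sum X Y) {z \<in> topspace (binary_sum X Y). map_sum p q z \<in> U} =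
      openin (binary_sum X' Y') U"
    using U by (simp add: openin_binary_sum Collect_restrict)
qed

lemma closedin_binary_sum:
  "closedin (binary_sum X Y) C \<longleftrightarrow>
     C \<subseteq> topspace X <+> topspace Y \<and> closedin X (Inl -` C) \<and> closedin Y (Inr -` C)"
proof -
  have "Inl -` ((topspace X <+> topspace Y) - C) = topspace X - Inl -` C"
    "Inr -` ((topspace X <+> topspace Y) - C) = topspace Y - Inr -` C"
    by auto
  then show ?thesis
    by (auto simp: closedin_def openin_binary_sum)
qed

lemma quotient_class_eqI:
  assumes "r x y"
  shows "quotient_class r x = quotient_class r y"
proof -
  have "equivclp r x y"
    using assms by blast
  then show ?thesis
    unfolding quotient_class_def by (blast intro: equivclp_trans equivclp_sym)
qed

lemma equivclp_imp_eq:
  assumes "equivclp r x y" and "\<And>x y. r x y \<Longrightarrow> h x = h y"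
  shows "h x = h y"
  using assms(1) by (induction rule: equivclp_induct) (use assms(2) in metis)+

lemma quotient_class_self: "x \<in> quotient_class r x"
  by (simp add: quotient_class_def)

section \<open>Normal forms for points of the mapping cone\<close>

text \<open>Both identifications in one map, the collapse to the cone followed by the gluing to
  \<open>Y\<close>, so that maps out of the mapping cone can be defined on
  \<open>Y + X \<times> I\<close>.\<close>

definition mapping_cone_proj ::
    "'x topology \<Rightarrow> 'x \<Rightarrow> ('x \<Rightarrow> 'y) \<Rightarrow> 'y + 'x \<times> real \<Rightarrow> ('y + ('x \<times> real) set) set" where
  "mapping_cone_proj X x0 f p =
     quotient_class (mapping_cone_rel X x0 f) (map_sum id (quotient_class (cone_rel X x0)) p)"

text \<open>Two points of \<open>Y + X \<times> I\<close> become equal in the mapping cone iff they have the same normal form.\<close>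

fun mapping_cone_normal_form :: "'x \<Rightarrow> ('x \<Rightarrow> 'y) \<Rightarrow> 'y + 'x \<times> real \<Rightarrow> 'y + 'x \<times> real" where
  "mapping_cone_normal_form x0 f (Inl y) = Inl y"
| "mapping_cone_normal_form x0 f (Inr (x, t)) =
     (if t = 0 then Inl (f x) else if t = 1 \<or> x = x0 then Inl (f x0) else Inr (x, t))"

lemma quotient_map_mapping_cone_proj:
  "quotient_map (binary_sum Y (prod_topology X unit_interval)) (mapping_cone Y X x0 f)
     (mapping_cone_proj X x0 f)"
proof -
  have "quotient_map (binary_sum Y (prod_topology X unit_interval)) (binary_sum Y (cone X x0))
      (map_sum id (quotient_class (cone_rel X x0)))"
    unfolding cone_def quotient_space_def
    by (intro quotient_map_binary_sum quotient_map_quotient_topology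
        continuous_open_quotient_map[THEN iffD2]) (auto simp: open_map_def)
  moreover have "quotient_map (binary_sum Y (cone X x0)) (mapping_cone Y X x0 f)
      (quotient_class (mapping_cone_rel X x0 f))"
    unfolding mapping_cone_def quotient_space_def by (rule quotient_map_quotient_topology)
  ultimately have "quotient_map (binary_sum Y (prod_topology X unit_interval)) (mapping_cone Y X x0 f)
      (quotient_class (mapping_cone_rel X x0 f) \<circ> map_sum id (quotient_class (cone_rel X x0)))"
    by (rule quotient_map_compose)
  then show ?thesis
    by (simp add: mapping_cone_proj_def[abs_def] o_def)
qed

lemma mapping_cone_proj_base:
  assumes "x \<in> topspace X"
  shows "mapping_cone_proj X x0 f (Inr (x, 0)) = mapping_cone_proj X x0 f (Inl (f x))"
proof -
  have "mapping_cone_rel X x0 f (Inl (f x)) (Inr (cone_point X x0 x 0))"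
    using assms by (auto simp: mapping_cone_rel_def)
  from quotient_class_eqI[of "mapping_cone_rel X x0 f", OF this] show ?thesis
    by (simp add: mapping_cone_proj_def cone_point_def)
qed

text \<open>The set collapsed in the cone contains \<open>(x0, 0)\<close>, which is glued to
  \<open>f x0\<close>.\<close>

lemma mapping_cone_proj_base_point:
  assumes "x0 \<in> topspace X" and "(x, t) \<in> {x0} \<times> {0..1} \<union> topspace X \<times> {1}"
  shows "mapping_cone_proj X x0 f (Inr (x, t)) = mapping_cone_proj X x0 f (Inl (f x0))"
proof -
  have "cone_rel X x0 (x, t) (x0, 0)"
    using assms by (auto simp: cone_rel_def)
  from quotient_class_eqI[of "cone_rel X x0", OF this]
  have "mapping_cone_proj X x0 f (Inr (x, t)) = mapping_cone_proj X x0 f (Inr (x0, 0))"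
    by (simp add: mapping_cone_proj_def)
  then show ?thesis
    using assms(1) by (simp add: mapping_cone_proj_base)
qed

lemma mapping_cone_proj_normal_form:
  assumes "x0 \<in> topspace X" and "p \<in> topspace (binary_sum Y (prod_topology X unit_interval))"
  shows "mapping_cone_proj X x0 f (mapping_cone_normal_form x0 f p) = mapping_cone_proj X x0 f p"
  using assms
  by (cases "(x0, f, p)" rule: mapping_cone_normal_form.cases)
    (auto simp: mapping_cone_proj_base mapping_cone_proj_base_point)

text \<open>The normal form is constant along \<open>cone_rel\<close>, so it descends to a function
  \<open>h\<close> on the sum of \<open>Y\<close> and the cone, independently of the representatives
  chosen by \<open>SOME\<close>. In turn \<open>h\<close> is constant along
  \<open>mapping_cone_rel\<close>.\<close>

lemma mapping_cone_proj_eq_imp_normal_form_eq: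
  assumes "mapping_cone_proj X x0 f p = mapping_cone_proj X x0 f q"
  shows "mapping_cone_normal_form x0 f p = mapping_cone_normal_form x0 f q"
proof -
  let ?nf = "mapping_cone_normal_form x0 f"
  define h where "h = case_sum Inl (\<lambda>c. ?nf (Inr (SOME z. z \<in> c)))"
  have some: "?nf (Inr (SOME z. z \<in> quotient_class (cone_rel X x0) z')) = ?nf (Inr z')" for z'
  proof -
    have "equivclp (cone_rel X x0) z' (SOME z. z \<in> quotient_class (cone_rel X x0) z')"
      using someI[of "\<lambda>z. z \<in> quotient_class (cone_rel X x0) z'", OF quotient_class_self]
      by (simp add: quotient_class_def)
    moreover have "?nf (Inr z) = ?nf (Inr z')" if "cone_rel X x0 z z'" for z z'
      using that by (auto simp: cone_rel_def)
    ultimately show ?thesis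
      using equivclp_imp_eq[of "cone_rel X x0" _ _ "\<lambda>z. ?nf (Inr z)"] by metis
  qed
  then have h: "h (map_sum id (quotient_class (cone_rel X x0)) z) = ?nf z" for z
    by (cases z) (auto simp: h_def)
  have "h z = h z'" if "mapping_cone_rel X x0 f z z'" for z z'
    using that some by (auto simp: mapping_cone_rel_def cone_point_def h_def)
  moreover have "equivclp (mapping_cone_rel X x0 f) (map_sum id (quotient_class (cone_rel X x0)) p)
      (map_sum id (quotient_class (cone_rel X x0)) q)"
    using assms quotient_class_self unfolding mapping_cone_proj_def quotient_class_def
    by (metis mem_Collect_eq)
  ultimately show ?thesis
    using equivclp_imp_eq[of "mapping_cone_rel X x0 f" _ _ h] h by metis
qed

section \<open>Continuity of the induced map\<close>

lemma mapping_cone_map_proj: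
  assumes "j \<in> topspace A \<rightarrow> topspace X" "j a0 = x0"
  shows "mapping_cone_map X x0 f j (mapping_cone_proj A a0 (f \<circ> j) p) =
    mapping_cone_proj X x0 f (map_sum id (map_prod j id) p)"
  using mapping_cone_map_class[OF assms, of f]
  by (cases p) (auto simp: mapping_cone_proj_def cone_point_def)

text \<open>It suffices to precompose with the quotient map from \<open>Y + A \<times> I\<close>,
  and the result is \<open>1 + j \<times> 1\<close> followed by a continuous projection.\<close>

lemma continuous_map_mapping_cone_map:
  assumes j: "continuous_map A X j" and "j a0 = x0"
  shows "continuous_map (mapping_cone Y A a0 (f \<circ> j)) (mapping_cone Y X x0 f)
    (mapping_cone_map X x0 f j)"
proof -
  let ?P = "mapping_cone_proj X x0 f"
  have "continuous_map (binary_sum Y (prod_topology X unit_interval)) (mapping_cone Y X x0 f) ?P"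
    using quotient_map_mapping_cone_proj by (rule quotient_imp_continuous_map)
  then have P: "continuous_map Y (mapping_cone Y X x0 f) (?P \<circ> Inl)"
      "continuous_map (prod_topology X unit_interval) (mapping_cone Y X x0 f) (?P \<circ> Inr)"
    by (simp_all add: continuous_map_from_binary_sum)
  have "continuous_map (prod_topology A unit_interval) (prod_topology X unit_interval) (map_prod j id)"
    unfolding map_prod_def using j by (simp add: continuous_map_prod_top)
  from continuous_map_compose[OF this P(2)]
  have "continuous_map (binary_sum Y (prod_topology A unit_interval)) (mapping_cone Y X x0 f)
      (?P \<circ> map_sum id (map_prod j id))"
    using P(1) by (simp add: continuous_map_from_binary_sum o_def)
  moreover have "?P \<circ> map_sum id (map_prod j id) =
      mapping_cone_map X x0 f j \<circ> mapping_cone_proj A a0 (f \<circ> j)"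
    using mapping_cone_map_proj[of j A X a0 x0 f] assms
    by (auto simp: fun_eq_iff continuous_map_def)
  ultimately show ?thesis
    using continuous_compose_quotient_map_eq[OF quotient_map_mapping_cone_proj] by metis
qed

section \<open>Maps of mapping cones\<close>

text \<open>The homotopy is built as \<open>K\<close> on
  \<open>(Y + X \<times> I) \<times> I\<close>, from \<open>G\<close> over \<open>Y\<close> and an
  extension \<open>H\<close> over \<open>X \<times> I\<close>. Being invariant under normal forms,
  \<open>K\<close> descends to the mapping cone.\<close>

lemma homotopy_extension_property_mapping_cone:
  fixes A :: "'a topology" and X :: "'x topology" and Y :: "'y topology" and W :: "'w topology"
  assumes cof: "free_cofibration TYPE('x + 'a \<times> real) A X j"
    and a0: "a0 \<in> topspace A" "j a0 = x0"
    and f: "continuous_map X Y f"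
  shows "homotopy_extension_property (mapping_cone Y A a0 (f \<circ> j)) (mapping_cone Y X x0 f)
    (mapping_cone_map X x0 f j) W"
  unfolding homotopy_extension_property_def
proof (intro allI impI)
  let ?I = unit_interval
  let ?CA = "mapping_cone Y A a0 (f \<circ> j)" and ?CX = "mapping_cone Y X x0 f"
  let ?J = "mapping_cone_map X x0 f j" and ?j = "map_sum id (map_prod j id)"
  let ?QA = "mapping_cone_proj A a0 (f \<circ> j)" and ?QX = "mapping_cone_proj X x0 f"
  let ?SA = "binary_sum Y (prod_topology A ?I)" and ?SX = "binary_sum Y (prod_topology X ?I)"
  have j: "continuous_map A X j"
    using cof by (simp add: free_cofibration_def)
  then have jA: "j \<in> topspace A \<rightarrow> topspace X"
    by (auto simp: continuous_map_def)
  then have x0: "x0 \<in> topspace X"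
    using a0 by auto
  have fX: "f x \<in> topspace Y" if "x \<in> topspace X" for x
    using f that by (auto simp: continuous_map_def)
  have QA: "quotient_map ?SA ?CA ?QA" and QX: "quotient_map ?SX ?CX ?QX"
    by (rule quotient_map_mapping_cone_proj)+
  then have QA_top: "?QA ` topspace ?SA = topspace ?CA" and QX_top: "?QX ` topspace ?SX = topspace ?CX"
    by (metis quotient_imp_surjective_map)+
  have QA_cont: "continuous_map Y ?CA (?QA \<circ> Inl)" "continuous_map (prod_topology A ?I) ?CA (?QA \<circ> Inr)"
    using quotient_imp_continuous_map[OF QA] by (simp_all add: continuous_map_from_binary_sum)
  have QX_cont: "continuous_map (prod_topology X ?I) ?CX (?QX \<circ> Inr)"
    using quotient_imp_continuous_map[OF QX] by (simp add: continuous_map_from_binary_sum)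
  have JQ: "?J (?QA p) = ?QX (?j p)" for p
    using jA a0(2) by (rule mapping_cone_map_proj)
  fix u G
  assume u: "continuous_map ?CX W u" and G: "continuous_map (prod_topology ?CA ?I) W G"
    and uG: "\<forall>c\<in>topspace ?CA. u (?J c) = G (c, 0)"
  have uG': "G (?QA p, 0) = u (?QX (?j p))" if "p \<in> topspace ?SA" for p
    using uG that QA_top JQ by (metis imageI)
  have G_comp: "continuous_map (prod_topology Z ?I) W (\<lambda>p. G (h (fst p), snd p))"
    if "continuous_map Z ?CA h" for Z :: "'z topology" and h
  proof -
    have "continuous_map (prod_topology Z ?I) (prod_topology ?CA ?I) (\<lambda>p. (h (fst p), snd p))"
      using continuous_map_compose[OF continuous_map_fst that]
      by (intro continuous_map_pairedI continuous_map_snd) (simp only: o_def)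
    from continuous_map_compose[OF this G] show ?thesis
      by (simp add: o_def)
  qed
  \<comment> \<open>The ends are forced: \<open>(x, 0)\<close> is glued to \<open>f x\<close>, and
    \<open>X \<times> {1}\<close> is collapsed to the class of \<open>f x0\<close>.\<close>
  define e0 where "e0 = (\<lambda>p. G (?QA (Inl (f (fst p))), snd p))"
  define e1 where "e1 = (\<lambda>p :: 'x \<times> real. G (?QA (Inl (f x0)), snd p))"
  define g where "g = (\<lambda>p. G (?QA (Inr (fst p)), snd p))"
  have e0: "continuous_map (prod_topology X ?I) W e0"
    using G_comp[OF continuous_map_compose[OF f QA_cont(1)]] by (simp add: e0_def o_def)
  have "continuous_map X ?CA (\<lambda>_. ?QA (Inl (f x0)))"
    using QA_top fX[OF x0] by auto
  from G_comp[OF this] have e1: "continuous_map (prod_topology X ?I) W e1"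
    by (simp add: e1_def)
  have g: "continuous_map (prod_topology (prod_topology A ?I) ?I) W g"
    using G_comp[OF QA_cont(2)] by (simp add: g_def o_def)
  have HEP: "homotopy_extension_property (prod_topology A ?I) (prod_topology X ?I) (\<lambda>(a, s). (j a, s)) W"
    using cof by (rule homotopy_extension_property_times)
      (auto intro!: compact_imp_locally_compact_space compact_space_subtopology Hausdorff_space_subtopology)
  obtain H where H: "continuous_map (prod_topology (prod_topology X ?I) ?I) W H"
    and H_bottom: "\<And>x s. x \<in> topspace X \<Longrightarrow> s \<in> {0..1} \<Longrightarrow> H ((x, s), 0) = (u \<circ> (?QX \<circ> Inr)) (x, s)"
    and H_left: "\<And>x t. x \<in> topspace X \<Longrightarrow> t \<in> {0..1} \<Longrightarrow> H ((x, 0), t) = e0 (x, t)"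
    and H_right: "\<And>x t. x \<in> topspace X \<Longrightarrow> t \<in> {0..1} \<Longrightarrow> H ((x, 1), t) = e1 (x, t)"
    and H_A: "\<And>a s t. a \<in> topspace A \<Longrightarrow> s \<in> {0..1} \<Longrightarrow> t \<in> {0..1} \<Longrightarrow> H ((j a, s), t) = g ((a, s), t)"
  proof (rule homotopy_extension_cylinder_rel_ends[OF HEP j continuous_map_compose[OF QX_cont u] e0 e1 g])
    fix x
    assume x: "x \<in> topspace X"
    show "(u \<circ> (?QX \<circ> Inr)) (x, 0) = e0 (x, 0)"
      using uG'[of "Inl (f x)"] fX[OF x] x by (simp add: e0_def mapping_cone_proj_base InlI)
    show "(u \<circ> (?QX \<circ> Inr)) (x, 1) = e1 (x, 0)"
      using uG'[of "Inl (f x0)"] fX[OF x0] x x0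
      by (simp add: e1_def mapping_cone_proj_base_point InlI)
  next
    fix a and s :: real
    assume a: "a \<in> topspace A" and s: "s \<in> {0..1}"
    show "g ((a, s), 0) = (u \<circ> (?QX \<circ> Inr)) (j a, s)"
      using uG'[of "Inr (a, s)"] a s by (simp add: g_def InrI)
    show "g ((a, 0), s) = e0 (j a, s)"
      using a by (simp add: g_def e0_def mapping_cone_proj_base)
    show "g ((a, 1), s) = e1 (j a, s)"
      using a a0 by (simp add: g_def e1_def mapping_cone_proj_base_point)
  qed (rule that)
  define K where "K = (\<lambda>(p, t). case p of Inl y \<Rightarrow> G (?QA (Inl y), t) | Inr q \<Rightarrow> H (q, t))"
  have K: "continuous_map (prod_topology ?SX ?I) W K"
  proof (rule continuous_map_from_binary_sum_times)
    show "continuous_map (prod_topology Y ?I) W (\<lambda>(y, t). K (Inl y, t))"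
      using G_comp[OF QA_cont(1)] by (simp add: K_def o_def case_prod_unfold)
    show "continuous_map (prod_topology (prod_topology X ?I) ?I) W (\<lambda>(q, t). K (Inr q, t))"
      using H by (simp add: K_def)
  qed
  have K_nf: "K (mapping_cone_normal_form x0 f p, t) = K (p, t)"
    if p: "p \<in> topspace ?SX" and t: "t \<in> {0..1}" for p t
  proof (cases p)
    case (Inl y)
    then show ?thesis by simp
  next
    case (Inr q)
    then obtain x s where q: "p = Inr (x, s)" and x: "x \<in> topspace X" and s: "s \<in> {0..1}"
      using p by (cases q) auto
    \<comment> \<open>Over \<open>{x0} \<times> I\<close> nothing was prescribed directly, but
      \<open>x0 = j a0\<close>, so \<open>H\<close> is given there by \<open>g\<close> over
      \<open>{a0} \<times> I\<close>, which the cone of \<open>A\<close> collapses.\<close>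
    have "H ((x0, s), t) = G (?QA (Inl (f x0)), t)"
      using H_A[OF a0(1) s t] s a0 by (simp add: g_def mapping_cone_proj_base_point)
    then show ?thesis
      using x t by (auto simp: q K_def H_left H_right e0_def e1_def)
  qed
  have QX_times: "quotient_map (prod_topology ?SX ?I) (prod_topology ?CX ?I) (\<lambda>(p, t). (?QX p, t))"
    using QX by (intro quotient_map_prod_left compact_imp_locally_compact_space
        compact_space_subtopology disjI1 Hausdorff_space_subtopology) auto
  have K_eq: "K z = K z'"
    if zs: "z \<in> topspace (prod_topology ?SX ?I)" "z' \<in> topspace (prod_topology ?SX ?I)"
      and zz': "(case z of (p, t) \<Rightarrow> (?QX p, t)) = (case z' of (p, t) \<Rightarrow> (?QX p, t))" for z z'
  proof -
    obtain p t p' where z: "z = (p, t)" "z' = (p', t)" and Q: "?QX p = ?QX p'"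
      using zz' by (cases z, cases z') auto
    have "p \<in> topspace ?SX" "p' \<in> topspace ?SX" "t \<in> {0..1}"
      using zs unfolding z topspace_prod_topology by simp_all
    then show ?thesis
      using K_nf mapping_cone_proj_eq_imp_normal_form_eq[OF Q] unfolding z by metis
  qed
  obtain L where L: "continuous_map (prod_topology ?CX ?I) W L"
    and "L ` topspace (prod_topology ?CX ?I) = K ` topspace (prod_topology ?SX ?I)"
    and LK: "\<And>z. z \<in> topspace (prod_topology ?SX ?I) \<Longrightarrow> L (case z of (p, t) \<Rightarrow> (?QX p, t)) = K z"
    by (rule quotient_map_lift_exists[OF QX_times K], rule K_eq, assumption+, rule that)
  have LK': "L (?QX p, t) = K (p, t)" if "p \<in> topspace ?SX" "t \<in> {0..1}" for p t
    using LK[of "(p, t)"] that by simp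
  have "L (?J (?QA p), t) = G (?QA p, t)" if p: "p \<in> topspace ?SA" and t: "t \<in> {0..1}" for p t
  proof -
    have "?j p \<in> topspace ?SX"
      using p jA by auto
    moreover have "K (?j p, t) = G (?QA p, t)"
      using p t by (auto simp: K_def H_A g_def)
    ultimately show ?thesis
      using LK' t by (simp add: JQ)
  qed
  moreover have "L (?QX p, 0) = u (?QX p)" if p: "p \<in> topspace ?SX" for p
  proof (cases p)
    case (Inl y)
    \<comment> \<open>\<open>Y\<close> is common to both mapping cones, so \<open>u\<close> is given
      on it by \<open>G\<close> at time 0.\<close>
    then have "Inl y \<in> topspace ?SA"
      using p by auto
    from uG'[OF this] show ?thesis
      using LK'[OF p, of 0] by (simp add: Inl K_def)
  next
    case (Inr q)
    then show ?thesis
      using LK'[OF p, of 0] p by (auto simp: K_def H_bottom)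
  qed
  ultimately show "\<exists>L. continuous_map (prod_topology ?CX ?I) W L \<and>
      (\<forall>c\<in>topspace ?CA. \<forall>t\<in>{0..1}. L (?J c, t) = G (c, t)) \<and> (\<forall>c\<in>topspace ?CX. L (c, 0) = u c)"
    using L unfolding QA_top[symmetric] QX_top[symmetric] by blast
qed

section \<open>Closedness of the induced map\<close>

text \<open>Closedness of the image of \<open>D\<close> is tested on its preimage \<open>E\<close>
  in \<open>Y + X \<times> I\<close>. Over \<open>Y\<close> this agrees with the preimage
  \<open>D'\<close> of \<open>D\<close>; over \<open>X \<times> I\<close> it is a finite union of
  closed sets.\<close>

lemma closed_map_mapping_cone_map:
  assumes j: "continuous_map A X j" "closed_map A X j" "inj_on j (topspace A)"
    and a0: "a0 \<in> topspace A" "j a0 = x0"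
    and f: "continuous_map X Y f"
  shows "closed_map (mapping_cone Y A a0 (f \<circ> j)) (mapping_cone Y X x0 f) (mapping_cone_map X x0 f j)"
  unfolding closed_map_def
proof (intro allI impI)
  let ?I = unit_interval
  let ?CA = "mapping_cone Y A a0 (f \<circ> j)" and ?CX = "mapping_cone Y X x0 f"
  let ?J = "mapping_cone_map X x0 f j" and ?j = "map_sum id (map_prod j id)"
  let ?QA = "mapping_cone_proj A a0 (f \<circ> j)" and ?QX = "mapping_cone_proj X x0 f"
  let ?SA = "binary_sum Y (prod_topology A ?I)" and ?SX = "binary_sum Y (prod_topology X ?I)"
  let ?nA = "mapping_cone_normal_form a0 (f \<circ> j)" and ?nX = "mapping_cone_normal_form x0 f"
  have jA: "j \<in> topspace A \<rightarrow> topspace X"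
    using j(1) by (auto simp: continuous_map_def)
  then have x0: "x0 \<in> topspace X"
    using a0 by auto
  have fX: "f x \<in> topspace Y" if "x \<in> topspace X" for x
    using f that by (auto simp: continuous_map_def)
  have QA: "quotient_map ?SA ?CA ?QA" and QX: "quotient_map ?SX ?CX ?QX"
    by (rule quotient_map_mapping_cone_proj)+
  have JQ: "?J (?QA p) = ?QX (?j p)" for p
    using jA a0(2) by (rule mapping_cone_map_proj)
  fix D
  assume D: "closedin ?CA D"
  define D' where "D' = {p \<in> topspace ?SA. ?QA p \<in> D}"
  define E where "E = {p \<in> topspace ?SX. ?QX p \<in> ?J ` D}"
  have D': "closedin ?SA D'"
    unfolding D'_def using quotient_imp_continuous_map[OF QA] D by (rule closedin_continuous_map_preimage)
  then have D'_closed: "closedin Y (Inl -` D')" "closedin (prod_topology A ?I) (Inr -` D')"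
    and D'_sub: "D' \<subseteq> topspace ?SA"
    by (simp_all add: closedin_binary_sum)
  have "D \<subseteq> ?QA ` topspace ?SA"
    using closedin_subset[OF D] quotient_imp_surjective_map[OF QA] by simp
  then have DD': "D = ?QA ` D'"
    unfolding D'_def by blast
  then have JD: "?J ` D = (\<lambda>d. ?QX (?j d)) ` D'"
    by (simp add: image_image JQ)
  have E_I: "p \<in> E" if "p \<in> topspace ?SX" "?QX p = ?QX (?j d)" "d \<in> D'" for p d
    using that by (simp add: E_def JD)
  \<comment> \<open>Injectivity enters: \<open>j a = x0\<close> forces \<open>a = a0\<close>, so
    \<open>j\<close> creates no new identifications with the base point.\<close>
  have n_j: "?nX (?j d) = ?j (?nA d)" if "d \<in> topspace ?SA" for d
    using that j(3) a0 by (auto simp: inj_on_eq_iff)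
  have E_D: "\<exists>d\<in>D'. ?nX p = ?j (?nA d)" if "p \<in> E" for p
  proof -
    from that obtain d where d: "d \<in> D'" "?QX p = ?QX (?j d)"
      by (auto simp: E_def JD)
    then have "?nX p = ?nX (?j d)"
      by (intro mapping_cone_proj_eq_imp_normal_form_eq)
    also have "\<dots> = ?j (?nA d)"
      by (rule n_j[OF subsetD[OF D'_sub d(1)]])
    finally show ?thesis
      using d(1) by blast
  qed
  \<comment> \<open>\<open>D'\<close> is saturated, so it contains the normal forms of its
    points.\<close>
  have nA_D: "q \<in> D'" if "d \<in> D'" "?nA d = q" "q \<in> topspace ?SA" for d q
  proof -
    have "?QA q = ?QA d"
      using mapping_cone_proj_normal_form[OF a0(1), of d Y "f \<circ> j"] that D'_sub by auto
    then show ?thesis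
      using that by (simp add: D'_def)
  qed
  have Inl_iff: "Inl y \<in> D'" if "Inl y = ?j (?nA d)" "d \<in> D'" "y \<in> topspace Y" for y d
    using that nA_D[of d "Inl y"] by (cases "?nA d") auto
  have "Inl -` E = Inl -` D'"
  proof (intro subset_antisym subsetI)
    fix y
    assume "y \<in> Inl -` E"
    then show "y \<in> Inl -` D'"
      using E_D[of "Inl y"] Inl_iff by (auto simp: E_def)
  next
    fix y
    assume "y \<in> Inl -` D'"
    then show "y \<in> Inl -` E"
      using E_I[of "Inl y" "Inl y"] D'_sub by auto
  qed
  \<comment> \<open>The terms are the points \<open>(x, 0)\<close> glued to a point of
    \<open>D'\<close> in \<open>Y\<close>, the image of \<open>D'\<close> under
    \<open>j \<times> 1\<close>, and the whole top if \<open>D\<close> contains the class of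
    \<open>f x0\<close>. The segment \<open>{x0} \<times> I\<close> gets no term of its own, being
    the image of \<open>{a0} \<times> I\<close>. All but the second are phrased with preimages, to
    make closedness immediate.\<close>
  moreover have "Inr -` E = {p \<in> topspace (prod_topology X ?I). snd p \<in> {0}} \<inter>
        {p \<in> topspace (prod_topology X ?I). (f \<circ> fst) p \<in> Inl -` D'} \<union>
      map_prod j id ` (Inr -` D') \<union>
      {p \<in> topspace (prod_topology X ?I). snd p \<in> (if Inl (f x0) \<in> D' then {1} else {})}"
    (is "_ = ?B \<inter> ?F \<union> ?M \<union> ?T")
  proof (intro subset_antisym subsetI)
    fix q
    assume q: "q \<in> Inr -` E"
    then obtain x s where xs: "q = (x, s)" "x \<in> topspace X" "s \<in> {0..1}"
      by (cases q) (auto simp: E_def)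
    have "Inr (x, s) \<in> E"
      using q xs(1) by simp
    from E_D[OF this] obtain d where d: "d \<in> D'" "?nX (Inr (x, s)) = ?j (?nA d)"
      by blast
    consider "s = 0" | "s \<noteq> 0" "s = 1" | "s \<noteq> 0" "s \<noteq> 1" "x = x0" | "s \<noteq> 0" "s \<noteq> 1" "x \<noteq> x0"
      by blast
    then show "q \<in> ?B \<inter> ?F \<union> ?M \<union> ?T"
    proof cases
      case 1
      then show ?thesis
        using d xs fX Inl_iff by auto
    next
      case 2
      then have "Inl (f x0) \<in> D'"
        using d fX[OF x0] Inl_iff by auto
      with 2 show ?thesis
        using xs by auto
    next
      case 3
      then have "Inl (f x0) \<in> D'"
        using d fX[OF x0] Inl_iff by auto
      then have "?QA (Inl (f x0)) \<in> D"
        by (simp add: D'_def)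
      moreover have "?QA (Inr (a0, s)) = ?QA (Inl (f x0))"
        using a0 xs(3) mapping_cone_proj_base_point[of a0 A a0 s "f \<circ> j"] by simp
      ultimately have "Inr (a0, s) \<in> D'"
        using a0 xs(3) by (simp add: D'_def InrI)
      then have "map_prod j id (a0, s) \<in> ?M"
        by blast
      with 3 show ?thesis
        using a0(2) xs(1) by simp
    next
      case 4
      then obtain a where a: "?nA d = Inr (a, s)" "j a = x"
        using d(2) by (cases "?nA d") auto
      \<comment> \<open>A normal form in the right summand arises only from the point
        itself.\<close>
      then have "d = Inr (a, s)"
        by (cases "(a0, f \<circ> j, d)" rule: mapping_cone_normal_form.cases) (auto split: if_splits)
      then have "map_prod j id (a, s) \<in> ?M"
        using d(1) by blast
      then show ?thesis
        using a xs(1) by simp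
    qed
  next
    fix q
    assume "q \<in> ?B \<inter> ?F \<union> ?M \<union> ?T"
    then consider x where "q = (x, 0)" "x \<in> topspace X" "Inl (f x) \<in> D'"
      | a s where "q = (j a, s)" "Inr (a, s) \<in> D'"
      | x where "q = (x, 1)" "x \<in> topspace X" "Inl (f x0) \<in> D'"
      by (auto split: if_splits)
    then show "q \<in> Inr -` E"
    proof cases
      case 1
      then show ?thesis
        using E_I[of "Inr q" "Inl (f x)"] by (simp add: mapping_cone_proj_base InrI)
    next
      case 2
      then show ?thesis
        using E_I[of "Inr q" "Inr (a, s)"] D'_sub jA by auto
    next
      case 3
      then show ?thesis
        using E_I[of "Inr q" "Inl (f x0)"] x0 by (simp add: mapping_cone_proj_base_point InrI)
    qed
  qed
  moreover have "closedin (prod_topology X ?I) (?B \<inter> ?F \<union> ?M \<union> ?T)"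
  proof (intro closedin_Un closedin_Int)
    show "closedin (prod_topology X ?I) ?B" "closedin (prod_topology X ?I) ?T"
      by (rule closedin_continuous_map_preimage[OF continuous_map_snd], simp)+
    show "closedin (prod_topology X ?I) ?F"
      by (rule closedin_continuous_map_preimage[OF _ D'_closed(1)])
        (rule continuous_map_compose[OF continuous_map_fst f])
    \<comment> \<open>A closed injective map is proper, and properness, unlike closedness alone,
      survives the product with the identity of \<open>I\<close>.\<close>
    have "proper_map (prod_topology A ?I) (prod_topology X ?I) (\<lambda>(a, t). (j a, id t))"
      using closed_injective_imp_proper_map[OF j(2,3)]
      by (simp add: proper_map_prod proper_map_id[unfolded id_def])
    then have "closed_map (prod_topology A ?I) (prod_topology X ?I) (map_prod j id)"
      unfolding map_prod_def by (rule proper_imp_closed_map)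
    then show "closedin (prod_topology X ?I) ?M"
      using D'_closed(2) by (simp add: closed_map_def)
  qed
  ultimately have "closedin ?SX E"
    using D'_closed(1) by (auto simp: closedin_binary_sum E_def)
  moreover have "?J ` D \<subseteq> topspace ?CX"
    using continuous_map_image_subset_topspace[OF continuous_map_mapping_cone_map[OF j(1) a0(2)]]
      closedin_subset[OF D] by blast
  ultimately show "closedin ?CX (?J ` D)"
    using QX unfolding quotient_map_closedin E_def by blast
qed

theorem proposition2p2:
  fixes A :: "'a topology" and X :: "'x topology" and Y :: "'y topology"
    and a0 :: 'a and x0 :: 'x and y0 :: 'y
    and j :: "'a \<Rightarrow> 'x" and f :: "'x \<Rightarrow> 'y"
  assumes "a0 \<in> topspace A" and "x0 \<in> topspace X" and "y0 \<in> topspace Y"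
    and "continuous_map A X j" and "j a0 = x0"
    and "continuous_map X Y f" and "f x0 = y0"
  shows "(free_cofibration TYPE('x + 'a \<times> real) A X j \<longrightarrow>
            free_cofibration TYPE('w)
              (mapping_cone Y A a0 (f \<circ> j)) (mapping_cone Y X x0 f) (mapping_cone_map X x0 f j)) \<and>
         (closed_free_cofibration TYPE('x + 'a \<times> real) A X j \<longrightarrow>
            closed_free_cofibration TYPE('w)
              (mapping_cone Y A a0 (f \<circ> j)) (mapping_cone Y X x0 f) (mapping_cone_map X x0 f j))"
proof -
  have "free_cofibration TYPE('w)
      (mapping_cone Y A a0 (f \<circ> j)) (mapping_cone Y X x0 f) (mapping_cone_map X x0 f j)"
    if "free_cofibration TYPE('x + 'a \<times> real) A X j"
    unfolding free_cofibration_def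
    using continuous_map_mapping_cone_map[OF assms(4,5)]
      homotopy_extension_property_mapping_cone[OF that assms(1,5,6)] by blast
  moreover have "closed_map
      (mapping_cone Y A a0 (f \<circ> j)) (mapping_cone Y X x0 f) (mapping_cone_map X x0 f j)"
    if "closed_free_cofibration TYPE('x + 'a \<times> real) A X j"
  proof (rule closed_map_mapping_cone_map)
    \<comment> \<open>Injectivity is tested on a space of type \<open>bool\<close>, so the assumed
      instance is first transferred to that type.\<close>
    show "inj_on j (topspace A)"
      using that free_cofibration_any_type free_cofibration_imp_inj_on
      unfolding closed_free_cofibration_def by blast
  qed (use that assms in \<open>auto simp: closed_free_cofibration_def\<close>)
  ultimately show ?thesis
    by (simp add: closed_free_cofibration_def)
qed

end
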